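(* Let $G=\mathbb{Z}/n\mathbb{Z}$ with $n\geq 3$ (not necessarily prime), and let $1\leq m<n$. If $m$ is even, let $$S_m:=\{\pm1,\pm2,\dots,\pm m/2\}\subset\widehat{G},$$ and if $m$ is odd, let $$S_m:=\{\pm1,\pm2,\dots,\pm(m-1)/2,\ (m+1)/2\}\subset\widehat{G}.$$ In either case, $$\beta_{\mathrm{field}}(G,S_m)=\gamma_{\mathrm{field}}(G,S_m)=\max\left(3,\left\lceil\frac{n}{\lceil m/2\rceil}\right\rceil\right).$$
   Context: $\widehat{G}=\operatorname{Hom}(G,\mathbf{k}^\times)$, where $\mathbf{k}$ is a field containing $n$ distinct $n$th roots of unity; fixing a primitive $n$th root of unity $\zeta$, an integer $A$ (mod $n$) represents the character $a\mapsto\zeta^{Aa}$. For a set $S\subset\widehat{G}\setminus\{1\}$ of distinct nontrivial characters, $\mathbb{Z}^S$ is the free abelian group with basis indexed by $S$, and $L(G,S)\subset\mathbb{Z}^S$ is the kernel of the homomorphism $\mathbb{Z}^S\to\widehat{G}$, $(a_\chi)_{\chi\in S}\mapsto\prod_{\chi\in S}\chi^{a_\chi}$. (In integer notation, $L(G,S)$ consists of the $(a_A)_{A\in S}$ with $\sum_{A\in S}A\,a_A\equiv0\pmod n$.) The degree of a point of $\mathbb{Z}^S$ with all coordinates nonnegative is the sum of its coordinates. $\beta_{\mathrm{field}}(G,S)$ is the least natural number $d$ such that $L(G,S)$ is generated as a group by its points with nonnegative coordinates and degree at most $d$; $\gamma_{\mathrm{field}}(G,S)$ is the least natural number $d$ such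 that those points generate a subgroup of rank $|S|$. *)

theory Defs
  imports
    "HOL-Algebra.Elementary_Groups"
    "HOL-Algebra.Free_Abelian_Groups"
    "HOL-Algebra.Multiplicative_Group"
    "HOL-Library.Extended_Nat"
    Complex_Main
begin

text \<open>The group of characters Hom(G, k\<open>\<^sup>\<times>\<close>) under pointwise multiplication. Characters are
  taken to be \<^const>\<open>undefined\<close> outside \<open>carrier G\<close>, so that equality of
  characters is equality of functions.\<close>

definition character_group ::
  "('g, 'x) monoid_scheme \<Rightarrow> ('k, 'y) ring_scheme \<Rightarrow> ('g \<Rightarrow> 'k) monoid" where
  "character_group G k =
     \<lparr>carrier = hom G (mult_of k) \<inter> extensional (carrier G),
      monoid.mult = (\<lambda>\<chi> \<psi>. \<lambda>g\<in>carrier G. \<chi> g \<otimes>\<^bsub>k\<^esub> \<psi> g),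
      one = (\<lambda>g\<in>carrier G. \<one>\<^bsub>k\<^esub>)\<rparr>"

text \<open>Elements of \<open>free_Abelian_group S\<close> vanish outside their finite set of keys,
  so products and sums over the keys are products and sums over \<open>S\<close>.\<close>

definition eval_characters ::
  "('g, 'x) monoid_scheme \<Rightarrow> ('k, 'y) ring_scheme \<Rightarrow> (('g \<Rightarrow> 'k) \<Rightarrow>\<^sub>0 int) \<Rightarrow> 'g \<Rightarrow> 'k" where
  "eval_characters G k a =
     finprod (character_group G k)
       (\<lambda>\<chi>. \<chi> [^]\<^bsub>character_group G k\<^esub> Poly_Mapping.lookup a \<chi>) (Poly_Mapping.keys a)"

definition character_lattice ::
  "('g, 'x) monoid_scheme \<Rightarrow> ('k, 'y) ring_scheme \<Rightarrow> ('g \<Rightarrow> 'k) set \<Rightarrow> (('g \<Rightarrow> 'k) \<Rightarrow>\<^sub>0 int) set" where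
  "character_lattice G k S =
     kernel (free_Abelian_group S) (character_group G k) (eval_characters G k)"

definition lattice_degree :: "('a \<Rightarrow>\<^sub>0 int) \<Rightarrow> int" where
  "lattice_degree a = (\<Sum>x\<in>Poly_Mapping.keys a. Poly_Mapping.lookup a x)"

definition bounded_points ::
  "('g, 'x) monoid_scheme \<Rightarrow> ('k, 'y) ring_scheme \<Rightarrow> ('g \<Rightarrow> 'k) set \<Rightarrow> nat
     \<Rightarrow> (('g \<Rightarrow> 'k) \<Rightarrow>\<^sub>0 int) set" where
  "bounded_points G k S d =
     {a \<in> character_lattice G k S.
        (\<forall>\<chi>\<in>S. 0 \<le> Poly_Mapping.lookup a \<chi>) \<and> lattice_degree a \<le> int d}"

text \<open>Rank of an abelian group: the largest size of a \<open>\<int>\<close>-linearly independent set,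
  valued in \<^typ>\<open>enat\<close> so that the supremum exists for every group.\<close>

definition int_independent :: "('a, 'x) monoid_scheme \<Rightarrow> 'a set \<Rightarrow> bool" where
  "int_independent A B \<longleftrightarrow>
     finite B \<and> B \<subseteq> carrier A \<and>
     (\<forall>c :: 'a \<Rightarrow> int. finprod A (\<lambda>b. b [^]\<^bsub>A\<^esub> c b) B = \<one>\<^bsub>A\<^esub> \<longrightarrow> (\<forall>b\<in>B. c b = 0))"

definition abelian_rank :: "('a, 'x) monoid_scheme \<Rightarrow> enat" where
  "abelian_rank A = (SUP B\<in>{B. int_independent A B}. enat (card B))"

definition beta_field ::
  "('g, 'x) monoid_scheme \<Rightarrow> ('k, 'y) ring_scheme \<Rightarrow> ('g \<Rightarrow> 'k) set \<Rightarrow> nat" where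
  "beta_field G k S =
     (LEAST d. generate (free_Abelian_group S) (bounded_points G k S d)
                 = character_lattice G k S)"

definition gamma_field ::
  "('g, 'x) monoid_scheme \<Rightarrow> ('k, 'y) ring_scheme \<Rightarrow> ('g \<Rightarrow> 'k) set \<Rightarrow> nat" where
  "gamma_field G k S =
     (LEAST d. abelian_rank (subgroup_generated (free_Abelian_group S) (bounded_points G k S d))
                 = enat (card S))"

text \<open>For \<open>\<zeta>\<close> with \<open>\<zeta>\<^sup>n = 1\<close>, the integer \<open>A\<close> represents the character \<open>a \<mapsto> \<zeta>\<^bsup>Aa\<^esup>\<close> of \<open>\<int>/n\<close>.\<close>

definition cyclic_character ::
  "('k, 'y) ring_scheme \<Rightarrow> nat \<Rightarrow> 'k \<Rightarrow> int \<Rightarrow> (int \<Rightarrow> 'k)" where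
  "cyclic_character k n \<zeta> A =
     (\<lambda>a\<in>carrier (integer_mod_group n). \<zeta> [^]\<^bsub>mult_of k\<^esub> (A * a))"

definition S_ints :: "nat \<Rightarrow> int set" where
  "S_ints m =
     (if even m then {1..int m div 2} \<union> uminus ` {1..int m div 2}
      else {1..(int m - 1) div 2} \<union> uminus ` {1..(int m - 1) div 2} \<union> {(int m + 1) div 2})"

definition S_chars :: "('k, 'y) ring_scheme \<Rightarrow> nat \<Rightarrow> 'k \<Rightarrow> nat \<Rightarrow> (int \<Rightarrow> 'k) set" where
  "S_chars k n \<zeta> m = cyclic_character k n \<zeta> ` S_ints m"

end

theory Submission
  imports Defs
begin

text \<open>Write \<open>M = \<lceil>m/2\<rceil>\<close> and \<open>q = \<lceil>n/M\<rceil>\<close>, and let \<open>e\<^sub>A\<close> be the basis vector of the character \<open>A\<close>.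
  Upper bound: modulo the points \<open>e\<^sub>A + e\<^sub>-\<^sub>A\<close> of degree 2 and
  \<open>e\<^sub>A\<^sub>+\<^sub>1 + e\<^sub>-\<^sub>A + e\<^sub>-\<^sub>1\<close> of degree 3, every \<open>e\<^sub>A\<close> is congruent to \<open>A e\<^sub>1\<close>. Hence an element of the
  lattice is congruent to a multiple of \<open>n e\<^sub>1\<close>, which is congruent to the point
  \<open>(q - 1) e\<^sub>M + e\<^sub>r\<close> of degree \<open>q\<close>, where \<open>r = n - (q - 1) M\<close>.

  Lower bound: points of degree \<open>d < q\<close> satisfy \<open>\<bar>\<Sum> A a\<^sub>A\<bar> \<le> d M < n\<close>, so they lie on the hyperplane
  \<open>\<Sum> A a\<^sub>A = 0\<close>. If instead \<open>q \<le> d \<le> 2\<close>, then \<open>-1\<close> belongs to the segment, and since \<open>e\<^sub>1\<close> can only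
  be completed by \<open>e\<^sub>-\<^sub>1\<close> in degree at most 2, the points lie on \<open>a\<^sub>1 = a\<^sub>-\<^sub>1\<close>. In both cases the rank is
  deficient.\<close>

section \<open>Rank of subgroups of free abelian groups\<close>

text \<open>Elimination without division: induct on the equations, and use one unknown with a
  nonzero coefficient to remove the current equation by cross-multiplication, so that all
  coefficients stay integers.\<close>

lemma int_homogeneous_system_nontrivial_solution:
  fixes v :: "'b \<Rightarrow> 'a \<Rightarrow> int"
  assumes "finite T" "finite B" "card T < card B"
  shows "\<exists>c. (\<exists>b\<in>B. c b \<noteq> 0) \<and> (\<forall>t\<in>T. (\<Sum>b\<in>B. c b * v b t) = 0)"
  using assms
proof (induction T arbitrary: B v rule: finite_induct)
  case empty
  then have "B \<noteq> {}" by auto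
  then show ?case by (intro exI[of _ "\<lambda>_. 1"]) auto
next
  case (insert t T)
  show ?case
  proof (cases "\<forall>b\<in>B. v b t = 0")
    case True
    have "card T < card B" using insert by simp
    from insert.IH[OF \<open>finite B\<close> this, of v] True show ?thesis by auto
  next
    case False
    then obtain p where p: "p \<in> B" "v p t \<noteq> 0" by blast
    \<comment> \<open>\<open>w b\<close> is the combination of \<open>v b\<close> and
      \<open>v p\<close> that vanishes at \<open>t\<close>; the remaining equations in
      \<open>w\<close> have one unknown fewer.\<close>
    define w where "w b s = v p t * v b s - v b t * v p s" for b s
    have "card T < card (B - {p})" using insert p by simp
    from insert.IH[OF _ this, of w] \<open>finite B\<close> obtain c where
      c: "\<exists>b\<in>B - {p}. c b \<noteq> 0" "\<And>s. s \<in> T \<Longrightarrow> (\<Sum>b\<in>B - {p}. c b * w b s) = 0" by auto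
    \<comment> \<open>Back substitution: scaling the other unknowns by \<open>v p t\<close> lets
      \<open>d p\<close> solve equation \<open>t\<close> exactly over the integers.\<close>
    define d where "d b = (if b = p then - (\<Sum>b\<in>B - {p}. c b * v b t) else v p t * c b)" for b
    have d: "(\<Sum>b\<in>B. d b * v b s) = (\<Sum>b\<in>B - {p}. c b * w b s)" for s
    proof -
      have "(\<Sum>b\<in>B. d b * v b s) = d p * v p s + (\<Sum>b\<in>B - {p}. d b * v b s)"
        using \<open>finite B\<close> p by (simp add: sum.remove)
      also have "(\<Sum>b\<in>B - {p}. d b * v b s) = (\<Sum>b\<in>B - {p}. v p t * c b * v b s)"
        by (rule sum.cong) (auto simp: d_def)
      also have "d p * v p s + \<dots> = (\<Sum>b\<in>B - {p}. c b * w b s)"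
        by (simp add: d_def w_def right_diff_distrib sum_subtractf sum_distrib_left mult_ac)
      finally show ?thesis .
    qed
    have "w b t = 0" for b by (simp add: w_def)
    then have "\<forall>s\<in>insert t T. (\<Sum>b\<in>B. d b * v b s) = 0"
      using c(2) by (auto simp: d)
    moreover have "\<exists>b\<in>B. d b \<noteq> 0"
      using c(1) p by (auto simp: d_def)
    ultimately show ?thesis by blast
  qed
qed

lemma finprod_int_pow_subgroup_free_Abelian_group:
  fixes S :: "'a set"
  defines "F \<equiv> free_Abelian_group S"
  assumes "finite B" "B \<subseteq> carrier (subgroup_generated F X)"
  shows "finprod (subgroup_generated F X) (\<lambda>b. b [^]\<^bsub>subgroup_generated F X\<^esub> (c b :: int)) B
           = (\<Sum>b\<in>B. frag_cmul (c b) b)"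
proof -
  interpret F: comm_group F
    unfolding F_def by (rule abelian_free_Abelian_group)
  interpret A: comm_group "subgroup_generated F X"
    by (rule F.abelian_subgroup_generated) (rule F.comm_group_axioms)
  have pow: "b [^]\<^bsub>subgroup_generated F X\<^esub> k = frag_cmul k b"
    if "b \<in> carrier (subgroup_generated F X)" for b and k :: int
  proof -
    have "b \<in> carrier F" using that F.carrier_subgroup_generated_subset by blast
    then show ?thesis using F.int_pow_subgroup_generated[OF that, of k]
      by (simp add: F_def)
  qed
  show ?thesis using assms(2,3)
  proof (induction B rule: finite_induct)
    case (insert b B)
    then have "b \<in> carrier (subgroup_generated F X)"
      "(\<lambda>b. b [^]\<^bsub>subgroup_generated F X\<^esub> c b) \<in> B \<rightarrow> carrier (subgroup_generated F X)" by auto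
    moreover from this have "b [^]\<^bsub>subgroup_generated F X\<^esub> c b \<in> carrier (subgroup_generated F X)"
      by simp
    ultimately have "finprod (subgroup_generated F X) (\<lambda>b. b [^]\<^bsub>subgroup_generated F X\<^esub> c b) (insert b B)
        = b [^]\<^bsub>subgroup_generated F X\<^esub> c b
          + finprod (subgroup_generated F X) (\<lambda>b. b [^]\<^bsub>subgroup_generated F X\<^esub> c b) B"
      using insert.hyps by (subst A.finprod_insert) (simp_all add: F_def)
    then show ?case using insert by (simp add: pow)
  next
    case empty
    then show ?case by simp (simp add: F_def)
  qed
qed

text \<open>Coordinates turn a relation in the group into a homogeneous integer system, to which
  elimination applies.\<close>

lemma int_independent_subgroup_free_Abelian_group:
  "int_independent (subgroup_generated (free_Abelian_group S) X) B \<longleftrightarrow>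
     finite B \<and> B \<subseteq> carrier (subgroup_generated (free_Abelian_group S) X) \<and>
     (\<forall>c. (\<forall>x. (\<Sum>b\<in>B. c b * Poly_Mapping.lookup b x) = 0) \<longrightarrow> (\<forall>b\<in>B. c b = 0))"
  unfolding int_independent_def
  by (auto simp: finprod_int_pow_subgroup_free_Abelian_group poly_mapping_eq_iff
      fun_eq_iff lookup_sum)

lemma lookup_subgroup_free_Abelian_group:
  assumes "b \<in> carrier (subgroup_generated (free_Abelian_group S) X)" "x \<notin> S"
  shows "Poly_Mapping.lookup b x = 0"
  using group.carrier_subgroup_generated_subset[OF group_free_Abelian_group, of S X] assms
  by (metis carrier_free_Abelian_group_iff not_in_keys_iff_lookup_eq_zero subset_iff)

lemma abelian_rank_le:
  assumes "\<And>B. int_independent A B \<Longrightarrow> card B \<le> r"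
  shows "abelian_rank A \<le> enat r"
  unfolding abelian_rank_def by (rule SUP_least) (use assms in simp)

text \<open>More than \<open>card S\<close> elements are dependent by elimination in
  \<open>card S\<close> coordinates; conversely the \<open>N\<close>-fold basis vectors are
  themselves independent, their supports being distinct singletons.\<close>

lemma abelian_rank_subgroup_free_Abelian_group_eq:
  assumes S: "finite S" and N: "N \<noteq> 0"
    and X: "\<And>x. x \<in> S \<Longrightarrow>
      frag_cmul N (frag_of x) \<in> carrier (subgroup_generated (free_Abelian_group S) X)"
  shows "abelian_rank (subgroup_generated (free_Abelian_group S) X) = enat (card S)"
proof (rule antisym)
  show "abelian_rank (subgroup_generated (free_Abelian_group S) X) \<le> enat (card S)"
  proof (rule abelian_rank_le, rule ccontr)
    fix B assume B: "int_independent (subgroup_generated (free_Abelian_group S) X) B"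
      and "\<not> card B \<le> card S"
    then obtain c where c: "\<exists>b\<in>B. c b \<noteq> 0"
      "\<And>x. x \<in> S \<Longrightarrow> (\<Sum>b\<in>B. c b * Poly_Mapping.lookup b x) = 0"
      using int_homogeneous_system_nontrivial_solution[OF S, of B Poly_Mapping.lookup]
      by (auto simp: int_independent_def)
    have "(\<Sum>b\<in>B. c b * Poly_Mapping.lookup b x) = 0" for x
    proof (cases "x \<in> S")
      case False
      then have "Poly_Mapping.lookup b x = 0" if "b \<in> B" for b
        using B that lookup_subgroup_free_Abelian_group[OF _ False]
        unfolding int_independent_def by blast
      then show ?thesis by simp
    qed (rule c)
    with c(1) B show False
      unfolding int_independent_subgroup_free_Abelian_group by blast
  qed
next
  define e where "e x = frag_cmul N (frag_of x)" for x :: 'a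
  have inj: "inj e"
  proof (rule injI)
    fix x y assume "e x = e y"
    then have "Poly_Mapping.keys (e x) = Poly_Mapping.keys (e y)" by simp
    then show "x = y" using N by (auto simp: e_def set_eq_iff)
  qed
  have "int_independent (subgroup_generated (free_Abelian_group S) X) (e ` S)"
    unfolding int_independent_subgroup_free_Abelian_group
  proof (intro conjI allI impI)
    fix c assume *: "\<forall>x. (\<Sum>b\<in>e ` S. c b * Poly_Mapping.lookup b x) = 0"
    show "\<forall>b\<in>e ` S. c b = 0"
    proof
      fix b assume "b \<in> e ` S"
      then obtain x where x: "x \<in> S" "b = e x" by auto
      have "(\<Sum>b\<in>e ` S. c b * Poly_Mapping.lookup b x) = (\<Sum>y\<in>S. if y = x then c (e x) * N else 0)"
        by (subst sum.reindex)
          (auto intro!: sum.cong simp: inj_on_subset[OF inj] e_def lookup_single_not_eq)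
      also have "\<dots> = c b * N" using x S by simp
      finally show "c b = 0" using * N by simp
    qed
  qed (use S X in \<open>auto simp: e_def\<close>)
  moreover have "card (e ` S) = card S" by (rule card_image) (use inj inj_on_subset in blast)
  ultimately show "enat (card S) \<le> abelian_rank (subgroup_generated (free_Abelian_group S) X)"
    unfolding abelian_rank_def by (metis (mono_tags, lifting) SUP_upper mem_Collect_eq)
qed

text \<open>On the span of \<open>X\<close> the coordinate at \<open>p\<close> is determined by the others, so an independent
  set stays independent after deleting that coordinate.\<close>

lemma abelian_rank_subgroup_free_Abelian_group_less:
  fixes w :: "'a \<Rightarrow> int"
  assumes S: "finite S" and p: "p \<in> S" "w p \<noteq> 0"
    and X: "\<And>a. a \<in> X \<Longrightarrow> (\<Sum>x\<in>S. w x * Poly_Mapping.lookup a x) = 0"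
  shows "abelian_rank (subgroup_generated (free_Abelian_group S) X) < enat (card S)"
proof -
  let ?A = "subgroup_generated (free_Abelian_group S) X"
  have w0: "(\<Sum>x\<in>S. w x * Poly_Mapping.lookup a x) = 0" if "a \<in> carrier ?A" for a
    using that unfolding carrier_subgroup_generated
  proof (induction rule: generate.induct)
    case (eng h1 h2)
    then show ?case by (simp add: lookup_add distrib_left sum.distrib)
  qed (simp_all add: X sum_negf)
  have "abelian_rank ?A \<le> enat (card S - 1)"
  proof (rule abelian_rank_le, rule ccontr)
    fix B assume B: "int_independent ?A B" and "\<not> card B \<le> card S - 1"
    then have "card (S - {p}) < card B" "finite B"
      using S p by (auto simp: int_independent_def)
    then obtain c where c: "\<exists>b\<in>B. c b \<noteq> 0"
      "\<And>x. x \<in> S - {p} \<Longrightarrow> (\<Sum>b\<in>B. c b * Poly_Mapping.lookup b x) = 0"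
      using int_homogeneous_system_nontrivial_solution[of "S - {p}" B Poly_Mapping.lookup] S
      by auto
    define y where "y x = (\<Sum>b\<in>B. c b * Poly_Mapping.lookup b x)" for x
    \<comment> \<open>The combination \<open>y\<close> inherits the relation \<open>w\<close>. As
      its coordinates in \<open>S\<close> other than \<open>p\<close> vanish,
      \<open>w p * y p = 0\<close> remains.\<close>
    have "(\<Sum>x\<in>S. w x * y x) = (\<Sum>b\<in>B. c b * (\<Sum>x\<in>S. w x * Poly_Mapping.lookup b x))"
      unfolding y_def sum_distrib_left by (subst sum.swap) (simp add: mult_ac)
    also have "\<dots> = 0" using B w0 by (intro sum.neutral) (auto simp: int_independent_def)
    finally have "w p * y p + (\<Sum>x\<in>S - {p}. w x * y x) = 0"
      using S p by (simp add: sum.remove)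
    moreover have "(\<Sum>x\<in>S - {p}. w x * y x) = 0"
      by (intro sum.neutral) (use c(2) in \<open>auto simp: y_def\<close>)
    ultimately have "y p = 0" using p by simp
    have "y x = 0" for x
    proof (cases "x \<in> S")
      case True
      then show ?thesis using \<open>y p = 0\<close> c(2) by (cases "x = p") (auto simp: y_def)
    next
      case False
      then have "Poly_Mapping.lookup b x = 0" if "b \<in> B" for b
        using B that lookup_subgroup_free_Abelian_group[OF _ False]
        unfolding int_independent_def by blast
      then show ?thesis by (simp add: y_def)
    qed
    with c(1) B show False
      unfolding int_independent_subgroup_free_Abelian_group y_def by blast
  qed
  \<comment> \<open>Positivity matters because \<open>card S - 1\<close> is truncated
    subtraction.\<close>
  moreover have "card S > 0" using S p by (auto simp: card_gt_0_iff)
  then have "enat (card S - 1) < enat (card S)" by simp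
  ultimately show ?thesis by (rule le_less_trans)
qed


section \<open>Characters of a cyclic group\<close>

lemma comm_group_mult_of:
  assumes "field k"
  shows "comm_group (mult_of k)"
proof -
  interpret field k by fact
  show ?thesis by (rule group.group_comm_groupI[OF field_mult_group]) (simp add: m_comm)
qed

text \<open>The group laws hold pointwise in \<open>mult_of k\<close>; commutativity there makes
  products and inverses of characters multiplicative again.\<close>

lemma comm_group_character_group:
  assumes "field k" "group G"
  shows "comm_group (character_group G k)"
proof -
  interpret M: comm_group "mult_of k" by (rule comm_group_mult_of[OF \<open>field k\<close>])
  interpret G: group G by fact
  have C: "character_group G k =
     \<lparr>carrier = hom G (mult_of k) \<inter> extensional (carrier G),
      monoid.mult = (\<lambda>\<chi> \<psi>. \<lambda>g\<in>carrier G. \<chi> g \<otimes>\<^bsub>mult_of k\<^esub> \<psi> g),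
      one = (\<lambda>g\<in>carrier G. \<one>\<^bsub>mult_of k\<^esub>)\<rparr>"
    by (simp add: character_group_def)
  have cl: "\<chi> g \<in> carrier (mult_of k)" if "\<chi> \<in> hom G (mult_of k)" "g \<in> carrier G" for \<chi> g
    using that by (auto simp: hom_def)
  show ?thesis unfolding C
  proof (rule comm_groupI; simp only: partial_object.simps monoid.simps)
    fix \<chi> \<psi>
    assume "\<chi> \<in> hom G (mult_of k) \<inter> extensional (carrier G)"
      "\<psi> \<in> hom G (mult_of k) \<inter> extensional (carrier G)"
    then show "(\<lambda>g\<in>carrier G. \<chi> g \<otimes>\<^bsub>mult_of k\<^esub> \<psi> g) \<in> hom G (mult_of k) \<inter> extensional (carrier G)"
      by (intro IntI homI restrict_extensional)
        (simp_all del: mult_mult_of carrier_mult_of add: cl hom_mult[of _ G "mult_of k"] M.m_ac)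
  next
    show "(\<lambda>g\<in>carrier G. \<one>\<^bsub>mult_of k\<^esub>) \<in> hom G (mult_of k) \<inter> extensional (carrier G)"
      by (intro IntI homI restrict_extensional)
        (simp_all del: mult_mult_of carrier_mult_of one_mult_of)
  next
    fix \<chi> assume \<chi>: "\<chi> \<in> hom G (mult_of k) \<inter> extensional (carrier G)"
    show "\<exists>\<psi>\<in>hom G (mult_of k) \<inter> extensional (carrier G).
      (\<lambda>g\<in>carrier G. \<psi> g \<otimes>\<^bsub>mult_of k\<^esub> \<chi> g) = (\<lambda>g\<in>carrier G. \<one>\<^bsub>mult_of k\<^esub>)"
    proof (intro bexI[of _ "\<lambda>g\<in>carrier G. inv\<^bsub>mult_of k\<^esub> \<chi> g"] IntI homI restrict_extensional)
      show "(\<lambda>g\<in>carrier G. (\<lambda>g\<in>carrier G. inv\<^bsub>mult_of k\<^esub> \<chi> g) g \<otimes>\<^bsub>mult_of k\<^esub> \<chi> g)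
        = (\<lambda>g\<in>carrier G. \<one>\<^bsub>mult_of k\<^esub>)"
        using \<chi> by (intro restrict_ext) (simp del: mult_mult_of carrier_mult_of one_mult_of add: cl)
    qed (use \<chi> in \<open>simp_all del: mult_mult_of carrier_mult_of add: cl hom_mult[of _ G "mult_of k"] M.inv_mult\<close>)
  next
    fix \<chi> assume \<chi>: "\<chi> \<in> hom G (mult_of k) \<inter> extensional (carrier G)"
    then show "(\<lambda>g\<in>carrier G. (\<lambda>g\<in>carrier G. \<one>\<^bsub>mult_of k\<^esub>) g \<otimes>\<^bsub>mult_of k\<^esub> \<chi> g) = \<chi>"
      by (intro extensionalityI[of _ "carrier G"])
        (simp_all del: mult_mult_of carrier_mult_of one_mult_of add: cl)
  qed (auto intro!: restrict_ext simp del: mult_mult_of carrier_mult_of simp: cl M.m_ac)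
qed

locale root_of_unity_field =
  fixes k :: "('k, 'y) ring_scheme" and n :: nat and \<zeta> :: 'k
  assumes field_k: "field k"
    and n_gt_1: "n > 1"
    and root: "\<zeta> \<in> carrier (mult_of k)" "group.ord (mult_of k) \<zeta> = n"
begin

abbreviation C where "C \<equiv> character_group (integer_mod_group n) k"
abbreviation \<chi> where "\<chi> \<equiv> cyclic_character k n \<zeta>"

sublocale M: comm_group "mult_of k" by (rule comm_group_mult_of[OF field_k])
sublocale C: comm_group C by (rule comm_group_character_group[OF field_k]) simp

lemma cyclic_character_hom: "\<chi> \<in> hom integer_group C"
proof (rule homI)
  fix A :: int
  have "\<chi> A \<in> hom (integer_mod_group n) (mult_of k)"
  proof (rule homI)
    fix a b assume "a \<in> carrier (integer_mod_group n)" "b \<in> carrier (integer_mod_group n)"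
    \<comment> \<open>Reducing \<open>a + b\<close> modulo \<open>n\<close> changes the exponent by
      a multiple of \<open>n\<close>, the order of \<zeta>.\<close>
    moreover have "\<zeta> [^]\<^bsub>mult_of k\<^esub> (A * ((a + b) mod int n)) = \<zeta> [^]\<^bsub>mult_of k\<^esub> (A * a + A * b)"
      unfolding M.int_pow_eq[OF root(1)] root(2) distrib_left[symmetric]
        right_diff_distrib[symmetric]
      by (rule dvd_mult) (simp add: mod_eq_dvd_iff[symmetric])
    moreover have "(a + b) mod int n \<in> carrier (integer_mod_group n)"
      using n_gt_1 by (simp add: carrier_integer_mod_group)
    ultimately show "\<chi> A (a \<otimes>\<^bsub>integer_mod_group n\<^esub> b) = \<chi> A a \<otimes>\<^bsub>mult_of k\<^esub> \<chi> A b"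
      by (simp add: cyclic_character_def M.int_pow_mult[OF root(1), symmetric]
          del: mult_mult_of)
  qed (use M.int_pow_closed[OF root(1)] in \<open>simp add: cyclic_character_def\<close>)
  then show "\<chi> A \<in> carrier C"
    by (simp add: character_group_def cyclic_character_def)
next
  fix A B :: int
  show "\<chi> (A \<otimes>\<^bsub>integer_group\<^esub> B) = \<chi> A \<otimes>\<^bsub>C\<^esub> \<chi> B"
    using M.int_pow_mult[OF root(1)]
    by (auto simp: character_group_def cyclic_character_def distrib_right
        intro!: restrict_ext)
qed

text \<open>The value at the generator 1 is the power of \<zeta> with exponent \<open>A\<close>,
  which determines \<open>A\<close> exactly modulo the order \<open>n\<close>.\<close>

lemma cyclic_character_eq_iff: "\<chi> A = \<chi> B \<longleftrightarrow> int n dvd A - B"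
proof
  assume "\<chi> A = \<chi> B"
  then have "\<chi> A 1 = \<chi> B 1" by simp
  then have "\<zeta> [^]\<^bsub>mult_of k\<^esub> A = \<zeta> [^]\<^bsub>mult_of k\<^esub> B"
    using n_gt_1 by (simp add: cyclic_character_def)
  then show "int n dvd A - B"
    using M.int_pow_eq[OF root(1)] root(2) by (simp add: dvd_diff_commute)
next
  assume "int n dvd A - B"
  then have "int n dvd (A * a - B * a)" for a
    by (simp add: left_diff_distrib[symmetric])
  then show "\<chi> A = \<chi> B"
    using M.int_pow_eq[OF root(1)] root(2)
    by (auto simp: cyclic_character_def dvd_diff_commute intro!: restrict_ext)
qed

lemma finprod_cyclic_character:
  assumes "finite J" "inj_on \<chi> J"
  shows "finprod C (\<lambda>\<psi>. \<psi> [^]\<^bsub>C\<^esub> (f \<psi> :: int)) (\<chi> ` J) = \<chi> (\<Sum>A\<in>J. A * f (\<chi> A))"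
proof -
  interpret h: group_hom integer_group C \<chi>
    by (intro group_hom.intro group_hom_axioms.intro) (auto simp: cyclic_character_hom C.group_axioms)
  have [simp]: "\<chi> A \<in> carrier C" for A using h.hom_closed by simp
  have pow: "\<chi> A [^]\<^bsub>C\<^esub> i = \<chi> (A * i)" for A i :: int
    using h.hom_int_pow[of A i] by (simp add: mult.commute)
  from assms show ?thesis
  proof (induction J rule: finite_induct)
    case empty
    then show ?case using h.hom_one by simp
  next
    case (insert A J)
    then show ?case using h.hom_mult
      by (simp only: image_insert, subst C.finprod_insert) (auto simp: pow)
  qed
qed

text \<open>Passage to integer notation: since \<chi> is a homomorphism, the product of characters
  is \<chi> of the weighted sum, and it is trivial iff \<open>n\<close> divides that sum.\<close>

lemma character_lattice_iff:
  assumes "finite I" "inj_on \<chi> I"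
  shows "a \<in> character_lattice (integer_mod_group n) k (\<chi> ` I) \<longleftrightarrow>
    Poly_Mapping.keys a \<subseteq> \<chi> ` I \<and> int n dvd (\<Sum>A\<in>I. A * Poly_Mapping.lookup a (\<chi> A))"
proof -
  have "eval_characters (integer_mod_group n) k a = \<chi> (\<Sum>A\<in>I. A * Poly_Mapping.lookup a (\<chi> A))"
    if keys: "Poly_Mapping.keys a \<subseteq> \<chi> ` I"
  proof -
    \<comment> \<open>\<open>eval_characters\<close> multiplies over the keys only; \<open>J\<close>
      is the set of integers representing them.\<close>
    define J where "J = {A \<in> I. Poly_Mapping.lookup a (\<chi> A) \<noteq> 0}"
    have "Poly_Mapping.keys a = \<chi> ` J" using keys by (auto simp: J_def in_keys_iff)
    moreover have "(\<Sum>A\<in>J. A * Poly_Mapping.lookup a (\<chi> A)) = (\<Sum>A\<in>I. A * Poly_Mapping.lookup a (\<chi> A))"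
      by (rule sum.mono_neutral_left) (auto simp: J_def assms)
    moreover have "finite J" "inj_on \<chi> J" using assms by (auto simp: J_def inj_on_def)
    ultimately show ?thesis by (simp add: eval_characters_def finprod_cyclic_character)
  qed
  moreover have "\<one>\<^bsub>C\<^esub> = \<chi> 0"
    by (auto simp: character_group_def cyclic_character_def)
  ultimately show ?thesis
    by (auto simp: character_lattice_def kernel_def cyclic_character_eq_iff)
qed

end


section \<open>The lattice of a symmetric segment of characters\<close>

text \<open>Both parities become one punctured interval from minus the floor to the ceiling of m/2.
  For odd \<open>m\<close> only the top element lacks its negative.\<close>

lemma S_ints_iff: "A \<in> S_ints m \<longleftrightarrow> A \<noteq> 0 \<and> - (int m div 2) \<le> A \<and> A \<le> (int m + 1) div 2"
proof -
  have "A \<in> uminus ` {1..b} \<longleftrightarrow> - b \<le> A \<and> A \<le> - 1" for b :: int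
    by (auto intro!: image_eqI[of _ _ "- A"])
  moreover have "(int m + 1) div 2 = int m div 2" if "even m" using that by auto
  moreover have "int m div 2 + 1 = (int m + 1) div 2" "(int m - 1) div 2 = int m div 2" if "odd m"
    using that by (auto elim!: oddE)
  ultimately show ?thesis unfolding S_ints_def by (cases "even m") auto
qed

text \<open>Describes what is left of a point of degree at most 2 once a basis vector is removed:
  zero or a single basis vector.\<close>

lemma nonneg_int_sum_le_1_cases:
  fixes f :: "'a \<Rightarrow> int"
  assumes "finite I" "\<And>x. x \<in> I \<Longrightarrow> 0 \<le> f x" "sum f I \<le> 1"
  obtains "\<And>x. x \<in> I \<Longrightarrow> f x = 0"
    | y where "y \<in> I" "\<And>x. x \<in> I \<Longrightarrow> f x = (if x = y then 1 else 0)"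
proof (cases "\<forall>x\<in>I. f x = 0")
  case False
  then obtain y where y: "y \<in> I" "f y \<ge> 1" using assms(2) by force
  have "f y + sum f (I - {y}) \<le> 1" using assms y by (simp add: sum.remove[symmetric])
  moreover have "sum f (I - {y}) \<ge> 0" using assms(2) by (intro sum_nonneg) auto
  ultimately have "f y = 1" "sum f (I - {y}) = 0" using y by auto
  then have "f x = 0" if "x \<in> I - {y}" for x
    using that assms sum_nonneg_eq_0_iff[of "I - {y}" f] by auto
  then show ?thesis using that(2)[of y] y \<open>f y = 1\<close> by auto
qed (use that in blast)

locale symmetric_character_segment = root_of_unity_field k n \<zeta>
  for k :: "('k, 'y) ring_scheme" and n \<zeta> +
  fixes m :: nat
  assumes n_ge_3: "n \<ge> 3" and m_ge_1: "m \<ge> 1" and m_less: "m < n"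
begin

section \<open>Integer coordinates, weight and degree\<close>

abbreviation I where "I \<equiv> S_ints m"
abbreviation M where "M \<equiv> (int m + 1) div 2"
abbreviation F where "F \<equiv> free_Abelian_group (\<chi> ` I)"
abbreviation L where "L \<equiv> character_lattice (integer_mod_group n) k (\<chi> ` I)"
abbreviation L\<^sub>b where "L\<^sub>b \<equiv> bounded_points (integer_mod_group n) k (\<chi> ` I)"

text \<open>An integer lift of the exponent of the product character: the lower bound needs its
  size, not just its residue modulo \<open>n\<close>.\<close>

definition weight :: "((int \<Rightarrow> 'k) \<Rightarrow>\<^sub>0 int) \<Rightarrow> int" where
  "weight a = (\<Sum>A\<in>I. A * Poly_Mapping.lookup a (\<chi> A))"

text \<open>Summing over the fixed set \<open>I\<close> instead of the varying keys makes additivity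
  immediate.\<close>

definition deg :: "((int \<Rightarrow> 'k) \<Rightarrow>\<^sub>0 int) \<Rightarrow> int" where
  "deg a = (\<Sum>A\<in>I. Poly_Mapping.lookup a (\<chi> A))"

definition e :: "int \<Rightarrow> (int \<Rightarrow> 'k) \<Rightarrow>\<^sub>0 int" where
  "e A = frag_of (\<chi> A)"

lemma finite_I: "finite I"
  by (rule finite_subset[of _ "{- (int m div 2)..(int m + 1) div 2}"]) (auto simp: S_ints_iff)

text \<open>Elements of \<open>I\<close> differ by at most \<open>m < n\<close>, so congruent ones
  are equal.\<close>

lemma inj_on_I: "inj_on \<chi> I"
proof (rule inj_onI)
  fix A B assume *: "A \<in> I" "B \<in> I" "\<chi> A = \<chi> B"
  then have "int n dvd A - B" by (simp add: cyclic_character_eq_iff)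
  moreover have "\<bar>A - B\<bar> < int n" using * m_less by (auto simp: S_ints_iff)
  ultimately show "A = B" using zdvd_not_zless[of "\<bar>A - B\<bar>" "int n"] by fastforce
qed

lemma lookup_e: "\<lbrakk>A \<in> I; B \<in> I\<rbrakk> \<Longrightarrow> Poly_Mapping.lookup (e A) (\<chi> B) = (if A = B then 1 else 0)"
  using inj_on_eq_iff[OF inj_on_I] by (auto simp: e_def lookup_single)

lemma weight_simps:
  "weight 0 = 0" "weight (a + b) = weight a + weight b" "weight (- a) = - weight a"
  "weight (frag_cmul c a) = c * weight a" "A \<in> I \<Longrightarrow> weight (e A) = A"
  by (simp_all add: weight_def lookup_add distrib_left sum.distrib sum_negf sum_distrib_left
      mult_ac lookup_e finite_I if_distrib[of "(*) _"] cong: if_cong)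

lemma deg_simps:
  "deg (a + b) = deg a + deg b" "deg (frag_cmul c a) = c * deg a" "A \<in> I \<Longrightarrow> deg (e A) = 1"
  by (simp_all add: deg_def lookup_add sum.distrib sum_distrib_left lookup_e finite_I)

lemma L_iff: "a \<in> L \<longleftrightarrow> Poly_Mapping.keys a \<subseteq> \<chi> ` I \<and> int n dvd weight a"
  unfolding weight_def by (rule character_lattice_iff[OF finite_I inj_on_I])

lemma lattice_degree_eq:
  assumes "Poly_Mapping.keys a \<subseteq> \<chi> ` I"
  shows "lattice_degree a = deg a"
proof -
  have "lattice_degree a = (\<Sum>x\<in>\<chi> ` I. Poly_Mapping.lookup a x)"
    unfolding lattice_degree_def using assms finite_I
    by (intro sum.mono_neutral_left) (auto simp: in_keys_iff)
  then show ?thesis by (simp add: deg_def sum.reindex[OF inj_on_I])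
qed

lemma L\<^sub>b_iff: "a \<in> L\<^sub>b d \<longleftrightarrow> Poly_Mapping.keys a \<subseteq> \<chi> ` I \<and> int n dvd weight a \<and>
    (\<forall>A\<in>I. 0 \<le> Poly_Mapping.lookup a (\<chi> A)) \<and> deg a \<le> int d"
  unfolding bounded_points_def by (auto simp: L_iff lattice_degree_eq)

lemma e_expansion:
  assumes "Poly_Mapping.keys a \<subseteq> \<chi> ` I"
  shows "a = (\<Sum>A\<in>I. frag_cmul (Poly_Mapping.lookup a (\<chi> A)) (e A))"
proof (rule poly_mapping_eqI)
  fix x
  show "Poly_Mapping.lookup a x =
    Poly_Mapping.lookup (\<Sum>A\<in>I. frag_cmul (Poly_Mapping.lookup a (\<chi> A)) (e A)) x"
  proof (cases "x \<in> \<chi> ` I")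
    case True
    then obtain B where B: "B \<in> I" "x = \<chi> B" by auto
    have "(\<Sum>A\<in>I. Poly_Mapping.lookup a (\<chi> A) * Poly_Mapping.lookup (e A) x)
      = (\<Sum>A\<in>I. if A = B then Poly_Mapping.lookup a x else 0)"
      by (rule sum.cong) (auto simp: B lookup_e)
    then show ?thesis using B finite_I by (simp add: lookup_sum)
  next
    case False
    then have "(\<Sum>A\<in>I. Poly_Mapping.lookup a (\<chi> A) * Poly_Mapping.lookup (e A) x) = 0"
      by (intro sum.neutral) (auto simp: e_def lookup_single)
    then show ?thesis using False assms by (auto simp: lookup_sum in_keys_iff)
  qed
qed

section \<open>Upper bound: generation in degree max(3, q)\<close>

lemma L\<^sub>b_subset_carrier: "L\<^sub>b d \<subseteq> carrier F"
  by (auto simp: L\<^sub>b_iff)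

lemma generate_L\<^sub>b_subset: "generate F (L\<^sub>b d) \<subseteq> L"
proof
  fix a assume "a \<in> generate F (L\<^sub>b d)"
  then show "a \<in> L"
  proof (induction rule: generate.induct)
    case (eng a b)
    then show ?case using keys_add[of a b] by (auto simp: L_iff weight_simps)
  qed (auto simp: L_iff L\<^sub>b_iff weight_simps)
qed

text \<open>The last two hypotheses say that \<open>q\<close> is the ceiling of n/M, in a form free
  of division.\<close>

lemma L_subset_generate_L\<^sub>b:
  assumes "3 \<le> d" "int d \<ge> q" "(q - 1) * M < int n" "int n \<le> q * M"
  shows "L \<subseteq> generate F (L\<^sub>b d)"
proof -
  define H where "H = generate F (L\<^sub>b d)"
  have add: "a + b \<in> H" if "a \<in> H" "b \<in> H" for a b
    using generate.eng[of a F _ b] that by (simp add: H_def)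
  have "subgroup H F" unfolding H_def
    by (rule group.generate_is_subgroup[OF group_free_Abelian_group L\<^sub>b_subset_carrier])
  then have "- a \<in> H" if "a \<in> H" for a
    using that subgroup.m_inv_closed[of H F a] subgroup.subset[of H F] by auto
  then have diff: "a - b \<in> H" if "a \<in> H" "b \<in> H" for a b
    using add[of a "- b"] that by simp
  have zero: "0 \<in> H" using generate.one[of F] by (simp add: H_def)
  have cmul: "frag_cmul c a \<in> H" if "a \<in> H" for c a
    by (rule frag_closure_minus_cmul[of "\<lambda>a. a \<in> H"]) (use zero diff that in auto)
  have sum: "sum f J \<in> H" if "\<And>x. x \<in> J \<Longrightarrow> f x \<in> H" for f and J :: "int set"
    using that by (induction J rule: infinite_finite_induct) (auto simp: zero add)
  have keys_e: "Poly_Mapping.keys (e A) \<subseteq> \<chi> ` I" if "A \<in> I" for A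
    using that by (auto simp: e_def)
  have keys_plus: "Poly_Mapping.keys (a + b) \<subseteq> \<chi> ` I"
    if "Poly_Mapping.keys a \<subseteq> \<chi> ` I" "Poly_Mapping.keys b \<subseteq> \<chi> ` I" for a b :: "(int \<Rightarrow> 'k) \<Rightarrow>\<^sub>0 int"
    using that keys_add[of a b] by blast
  have nonneg_e: "0 \<le> Poly_Mapping.lookup (e A) x" for A x
    by (simp add: e_def lookup_single)
  have M: "M \<ge> 1" using m_ge_1 by auto
  have e2: "e A + e (- A) \<in> H" if "A \<in> I" "- A \<in> I" for A
    unfolding H_def
  proof (rule generate.incl)
    have "Poly_Mapping.keys (e A + e (- A)) \<subseteq> \<chi> ` I"
      by (intro keys_plus keys_e that)
    then show "e A + e (- A) \<in> L\<^sub>b d"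
      using that assms by (simp add: L\<^sub>b_iff weight_simps deg_simps lookup_add nonneg_e)
  qed
  have e3: "e (A + 1) + (e (- A) + e (- 1)) \<in> H" if "A + 1 \<in> I" "- A \<in> I" "- 1 \<in> I" for A
    unfolding H_def
  proof (rule generate.incl)
    have "Poly_Mapping.keys (e (A + 1) + (e (- A) + e (- 1))) \<subseteq> \<chi> ` I"
      by (intro keys_plus keys_e that)
    then show "e (A + 1) + (e (- A) + e (- 1)) \<in> L\<^sub>b d"
      using that assms by (simp add: L\<^sub>b_iff weight_simps deg_simps lookup_add nonneg_e)
  qed
  have pos: "e A - frag_cmul A (e 1) \<in> H" if "1 \<le> A" "A \<le> M" for A
    using that
  proof (induction A rule: int_ge_induct)
    case base
    then show ?case by (simp add: zero)
  next
    case (step A)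
    \<comment> \<open>Here \<open>A + 1 \<le> M\<close>, so \<open>- A\<close> and
      \<open>- 1\<close> lie in \<open>I\<close> even for odd \<open>m\<close>, where
      \<open>- M\<close> is missing.\<close>
    then have I: "A \<in> I" "- A \<in> I" "1 \<in> I" "- 1 \<in> I" "A + 1 \<in> I" by (auto simp: S_ints_iff)
    have "e (A + 1) - frag_cmul (A + 1) (e 1) =
      (e (A + 1) + (e (- A) + e (- 1))) - (e A + e (- A)) - (e 1 + e (- 1))
        + (e A - frag_cmul A (e 1))"
      by (simp add: frag_cmul_distrib)
    moreover have "e A - frag_cmul A (e 1) \<in> H" using step by simp
    ultimately show ?case using e2[of A] e2[of 1] e3[of A] I by (simp only: add diff)
  qed
  have e_cong: "e A - frag_cmul A (e 1) \<in> H" if "A \<in> I" for A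
  proof (cases "A > 0")
    case True
    then show ?thesis using that pos by (auto simp: S_ints_iff)
  next
    case False
    then have "- A \<in> I" "1 \<le> - A" "- A \<le> M" using that by (auto simp: S_ints_iff)
    moreover have "e A - frag_cmul A (e 1) = (e A + e (- A)) - (e (- A) - frag_cmul (- A) (e 1))"
      by (simp add: minus_frag_cmul[symmetric] del: minus_frag_cmul)
    ultimately show ?thesis using that e2[of A] pos[of "- A"] by (simp only: diff)
  qed
  have n_e1: "frag_cmul (int n) (e 1) \<in> H"
  proof -
    \<comment> \<open>The remainder is taken in 1..M rather than 0..M-1, so that it always names an
      element of \<open>I\<close>; the point then has degree (q - 1) + 1 = q.\<close>
    define r where "r = int n - (q - 1) * M"
    have r: "1 \<le> r" "r \<le> M" using assms by (auto simp: r_def left_diff_distrib)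
    have q: "q \<ge> 1"
    proof (rule ccontr)
      assume "\<not> q \<ge> 1"
      then have "q * M \<le> 0" using M by (simp add: mult_nonpos_nonneg)
      then show False using assms n_ge_3 by simp
    qed
    have I: "r \<in> I" "M \<in> I" using r M by (auto simp: S_ints_iff)
    have "frag_cmul (q - 1) (e M) + e r \<in> H" unfolding H_def
    proof (rule generate.incl)
      have "Poly_Mapping.keys (frag_cmul (q - 1) (e M) + e r) \<subseteq> \<chi> ` I"
        by (intro keys_plus order_trans[OF keys_cmul] keys_e I)
      then show "frag_cmul (q - 1) (e M) + e r \<in> L\<^sub>b d"
        using I q assms
        by (simp add: L\<^sub>b_iff weight_simps deg_simps lookup_add nonneg_e r_def del: minus_frag_cmul)
    qed
    moreover have "frag_cmul (int n) (e 1) = (frag_cmul (q - 1) (e M) + e r)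
      - frag_cmul (q - 1) (e M - frag_cmul M (e 1)) - (e r - frag_cmul r (e 1))"
      by (rule poly_mapping_eqI) (simp add: lookup_add lookup_minus r_def algebra_simps)
    ultimately show ?thesis using e_cong[OF I(1)] e_cong[OF I(2)] by (simp only: diff cmul)
  qed
  show ?thesis
  proof
    fix a assume a: "a \<in> L"
    then obtain c where c: "weight a = int n * c" unfolding L_iff dvd_def by blast
    \<comment> \<open>These terms replace each \<open>e A\<close> by \<open>A\<close> copies of
      \<open>e 1\<close>, leaving \<open>weight a\<close> copies in all, a multiple of
      \<open>n\<close>.\<close>
    let ?b = "\<lambda>A. frag_cmul (Poly_Mapping.lookup a (\<chi> A)) (e A - frag_cmul A (e 1))"
    have "a = (\<Sum>A\<in>I. frag_cmul (Poly_Mapping.lookup a (\<chi> A)) (e A))"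
      using a by (intro e_expansion) (simp add: L_iff)
    also have "\<dots> = (\<Sum>A\<in>I. ?b A) + frag_cmul (weight a) (e 1)"
      by (rule poly_mapping_eqI)
        (simp add: lookup_add lookup_minus lookup_sum weight_def right_diff_distrib
          sum_subtractf sum_distrib_left mult_ac)
    also have "frag_cmul (weight a) (e 1) = frag_cmul c (frag_cmul (int n) (e 1))"
      by (simp add: c mult.commute)
    finally have "a = (\<Sum>A\<in>I. ?b A) + frag_cmul c (frag_cmul (int n) (e 1))" .
    moreover have "(\<Sum>A\<in>I. ?b A) + frag_cmul c (frag_cmul (int n) (e 1)) \<in> H"
      by (intro add sum cmul n_e1 e_cong)
    ultimately show "a \<in> generate F (L\<^sub>b d)" by (simp add: H_def)
  qed
qed

text \<open>\<open>L\<close> contains \<open>n\<close> times every basis vector and so has full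
  rank. This gives the inequality of gamma by beta.\<close>

lemma abelian_rank_eq_if_generate:
  assumes "generate F (L\<^sub>b d) = L"
  shows "abelian_rank (subgroup_generated F (L\<^sub>b d)) = enat (card (\<chi> ` I))"
proof (rule abelian_rank_subgroup_free_Abelian_group_eq)
  fix x assume "x \<in> \<chi> ` I"
  then obtain A where "A \<in> I" "x = \<chi> A" by auto
  then have "frag_cmul (int n) (e A) \<in> L"
    by (auto simp: L_iff weight_simps e_def)
  moreover have "carrier (subgroup_generated F (L\<^sub>b d)) = L"
    by (simp only: carrier_subgroup_generated Int_absorb1[OF L\<^sub>b_subset_carrier] assms)
  ultimately show "frag_cmul (int n) (frag_of x) \<in> carrier (subgroup_generated F (L\<^sub>b d))"
    using \<open>x = \<chi> A\<close> by (simp add: e_def)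
qed (use n_gt_1 finite_I in auto)

section \<open>Lower bound: rank deficiency below degree max(3, q)\<close>

lemma abelian_rank_less_if_relation:
  assumes "A\<^sub>0 \<in> I" "w A\<^sub>0 \<noteq> 0"
    and "\<And>a. a \<in> L\<^sub>b d \<Longrightarrow> (\<Sum>A\<in>I. w A * Poly_Mapping.lookup a (\<chi> A)) = 0"
  shows "abelian_rank (subgroup_generated F (L\<^sub>b d)) < enat (card (\<chi> ` I))"
proof (rule abelian_rank_subgroup_free_Abelian_group_less[where w = "w \<circ> inv_into I \<chi>"])
  fix a assume "a \<in> L\<^sub>b d"
  then show "(\<Sum>x\<in>\<chi> ` I. (w \<circ> inv_into I \<chi>) x * Poly_Mapping.lookup a x) = 0"
    using assms(3)
    by (simp add: sum.reindex[OF inj_on_I] inv_into_f_f[OF inj_on_I])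
qed (use assms finite_I in \<open>auto simp: inv_into_f_f[OF inj_on_I]\<close>)

lemma weight_eq_0:
  assumes "a \<in> L\<^sub>b d" "int d < q" "(q - 1) * M < int n"
  shows "weight a = 0"
proof -
  have "\<bar>weight a\<bar> \<le> (\<Sum>A\<in>I. \<bar>A * Poly_Mapping.lookup a (\<chi> A)\<bar>)"
    unfolding weight_def by (rule sum_abs)
  also have "\<dots> \<le> (\<Sum>A\<in>I. M * Poly_Mapping.lookup a (\<chi> A))"
  proof (rule sum_mono)
    fix A assume A: "A \<in> I"
    then have "\<bar>A\<bar> \<le> M" "0 \<le> Poly_Mapping.lookup a (\<chi> A)"
      using assms by (auto simp: S_ints_iff L\<^sub>b_iff)
    then show "\<bar>A * Poly_Mapping.lookup a (\<chi> A)\<bar> \<le> M * Poly_Mapping.lookup a (\<chi> A)"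
      by (simp add: abs_mult mult_right_mono)
  qed
  also have "\<dots> = M * deg a" by (simp add: deg_def sum_distrib_left)
  \<comment> \<open>For integers \<open>int d < q\<close> means a degree of at most
    \<open>q - 1\<close>, just small enough for the product with \<open>M\<close> to stay below
    \<open>n\<close>.\<close>
  also have "\<dots> \<le> M * (q - 1)" using assms by (intro mult_left_mono) (auto simp: L\<^sub>b_iff)
  also have "\<dots> < int n" using assms by (simp add: mult.commute)
  finally have "\<bar>weight a\<bar> < int n" .
  moreover have "int n dvd weight a" using assms by (simp add: L\<^sub>b_iff)
  ultimately show ?thesis using zdvd_not_zless[of "\<bar>weight a\<bar>" "int n"] by fastforce
qed

text \<open>Removing one copy of \<open>e c\<close> leaves zero or some \<open>e B\<close>. Zero is
  impossible since \<open>n\<close> does not divide \<open>c\<close>; otherwise \<open>n\<close>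
  divides \<open>B + c\<close>, and injectivity of \<chi> on \<open>I\<close> forces
  \<open>B = - c\<close>.\<close>

lemma lookup_uminus_eq_1:
  assumes a: "a \<in> L\<^sub>b d" "d \<le> 2" and c: "c \<in> I" "- c \<in> I" "Poly_Mapping.lookup a (\<chi> c) \<noteq> 0"
  shows "Poly_Mapping.lookup a (\<chi> c) = 1 \<and> Poly_Mapping.lookup a (\<chi> (- c)) = 1"
proof -
  define f where "f A = Poly_Mapping.lookup a (\<chi> A) - Poly_Mapping.lookup (e c) (\<chi> A)" for A
  have "0 \<le> f A" if "A \<in> I" for A
    using that a c by (force simp: f_def lookup_e L\<^sub>b_iff)
  moreover have "sum f I = deg a - 1"
    using c deg_simps(3)[of c] by (simp add: f_def sum_subtractf deg_def)
  then have "sum f I \<le> 1" using a by (simp add: L\<^sub>b_iff)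
  ultimately consider "\<And>A. A \<in> I \<Longrightarrow> f A = 0"
    | B where "B \<in> I" "\<And>A. A \<in> I \<Longrightarrow> f A = (if A = B then 1 else 0)"
    using nonneg_int_sum_le_1_cases[OF finite_I, of f] by metis
  moreover have weight_f: "(\<Sum>A\<in>I. A * f A) = weight a - c"
    using c weight_simps(5)[of c] by (simp add: f_def sum_subtractf weight_def right_diff_distrib)
  moreover have "0 < \<bar>c\<bar>" "\<bar>c\<bar> < int n" using c m_less by (auto simp: S_ints_iff)
  then have "\<not> int n dvd c" using zdvd_not_zless[of "\<bar>c\<bar>" "int n"] by simp
  ultimately show ?thesis
  proof cases
    case 1
    then have "weight a = c" using weight_f by simp
    with \<open>\<not> int n dvd c\<close> a show ?thesis by (simp add: L\<^sub>b_iff)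
  next
    case (2 B)
    then have "(\<Sum>A\<in>I. A * f A) = (\<Sum>A\<in>I. if A = B then B else 0)" by (intro sum.cong) auto
    then have "weight a = B + c" using weight_f 2 finite_I by simp
    then have "\<chi> B = \<chi> (- c)" using a by (simp add: L\<^sub>b_iff cyclic_character_eq_iff)
    then have "B = - c" using inj_on_I 2 c by (auto dest: inj_onD)
    \<comment> \<open>Hence \<open>c\<close> and \<open>- c\<close> are different indices, and each
      coordinate is 1 rather than one of them being 2.\<close>
    moreover have "c \<noteq> 0" using c by (auto simp: S_ints_iff)
    ultimately show ?thesis using 2(2)[of c] 2(2)[of "- c"] c by (simp add: f_def lookup_e)
  qed
qed

lemma abelian_rank_less:
  assumes q: "(q - 1) * M < int n" "int n \<le> q * M" and d: "int d < max 3 q"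
  shows "abelian_rank (subgroup_generated F (L\<^sub>b d)) < enat (card (\<chi> ` I))"
proof (cases "int d < q")
  case True
  have "(\<Sum>A\<in>I. id A * Poly_Mapping.lookup a (\<chi> A)) = 0" if "a \<in> L\<^sub>b d" for a
    using weight_eq_0[OF that True q(1)] by (simp add: weight_def)
  then show ?thesis
    using m_ge_1 by (intro abelian_rank_less_if_relation[of 1 id]) (auto simp: S_ints_iff)
next
  case False
  then have "d \<le> 2" "q \<le> 2" using d by auto
  then have "q * M \<le> 2 * M" by (intro mult_right_mono) auto
  \<comment> \<open>From \<open>q \<le> 2\<close> follows \<open>n \<le> 2 * M\<close>, and
    \<open>n \<ge> 3\<close> excludes \<open>M = 1\<close>; thus \<open>- 1\<close> is
    available.\<close>
  then have "M \<ge> 2" using q n_ge_3 by linarith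
  then have I: "1 \<in> I" "- 1 \<in> I" by (auto simp: S_ints_iff)
  define w :: "int \<Rightarrow> int" where "w A = (if A = 1 then 1 else 0) - (if A = - 1 then 1 else 0)" for A
  have "(\<Sum>A\<in>I. w A * Poly_Mapping.lookup a (\<chi> A)) = 0" if a: "a \<in> L\<^sub>b d" for a
  proof -
    have "(\<Sum>A\<in>I. w A * Poly_Mapping.lookup a (\<chi> A)) =
      (\<Sum>A\<in>I. (if A = 1 then Poly_Mapping.lookup a (\<chi> A) else 0)
        - (if A = - 1 then Poly_Mapping.lookup a (\<chi> A) else 0))"
      by (rule sum.cong) (auto simp: w_def)
    also have "\<dots> = Poly_Mapping.lookup a (\<chi> 1) - Poly_Mapping.lookup a (\<chi> (- 1))"
      using I finite_I by (simp add: sum_subtractf)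
    also have "\<dots> = 0"
      \<comment> \<open>If either coordinate is nonzero, both equal 1; otherwise both are 0.\<close>
      using lookup_uminus_eq_1[OF a \<open>d \<le> 2\<close>, of 1] lookup_uminus_eq_1[OF a \<open>d \<le> 2\<close>, of "- 1"] I
      by (metis add.inverse_inverse eq_iff_diff_eq_0)
    finally show ?thesis .
  qed
  then show ?thesis using I by (intro abelian_rank_less_if_relation[of 1 w]) (auto simp: w_def)
qed

text \<open>Generation at max(3, q) implies full rank there, while below it the rank is deficient
  and so generation fails too. The same threshold is therefore least for both invariants.\<close>

lemma beta_gamma_field_eq:
  assumes q: "(q - 1) * M < int n" "int n \<le> q * M"
  shows "int (beta_field (integer_mod_group n) k (\<chi> ` I)) = max 3 q"
    and "int (gamma_field (integer_mod_group n) k (\<chi> ` I)) = max 3 q"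
proof -
  have gen: "generate F (L\<^sub>b (nat (max 3 q))) = L"
    by (intro subset_antisym generate_L\<^sub>b_subset L_subset_generate_L\<^sub>b[OF _ _ q]) auto
  have le: "nat (max 3 q) \<le> d"
    if "abelian_rank (subgroup_generated F (L\<^sub>b d)) = enat (card (\<chi> ` I))" for d
    using abelian_rank_less[OF q, of d] that by (cases "int d < max 3 q") auto
  have "beta_field (integer_mod_group n) k (\<chi> ` I) = nat (max 3 q)"
    unfolding beta_field_def
    by (rule Least_equality) (use gen le abelian_rank_eq_if_generate in auto)
  then show "int (beta_field (integer_mod_group n) k (\<chi> ` I)) = max 3 q" by simp
  have "gamma_field (integer_mod_group n) k (\<chi> ` I) = nat (max 3 q)"
    unfolding gamma_field_def
    by (rule Least_equality) (use gen le abelian_rank_eq_if_generate in auto)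
  then show "int (gamma_field (integer_mod_group n) k (\<chi> ` I)) = max 3 q" by simp
qed

end

theorem proposition5p2:
  fixes k :: "('k, 'y) ring_scheme" and \<zeta> :: 'k and n m :: nat
  assumes "field k"
    and "n \<ge> 3" and "1 \<le> m" and "m < n"
    and "card {x \<in> carrier k. x [^]\<^bsub>k\<^esub> n = \<one>\<^bsub>k\<^esub>} = n"
    and "\<zeta> \<in> carrier (mult_of k)" and "group.ord (mult_of k) \<zeta> = n"
  shows "int (beta_field (integer_mod_group n) k (S_chars k n \<zeta> m))
           = max 3 \<lceil>real n / real_of_int \<lceil>real m / 2\<rceil>\<rceil>
         \<and> int (gamma_field (integer_mod_group n) k (S_chars k n \<zeta> m))
           = max 3 \<lceil>real n / real_of_int \<lceil>real m / 2\<rceil>\<rceil>"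
proof -
  interpret symmetric_character_segment k n \<zeta> m
    by (intro symmetric_character_segment.intro root_of_unity_field.intro
        symmetric_character_segment_axioms.intro) (use assms in auto)
  have half: "\<lceil>real m / 2\<rceil> = (int m + 1) div 2"
    using ceiling_divide_eq_div[where 'a = real, of "int m" 2] by simp
  define q where "q = \<lceil>real n / real_of_int \<lceil>real m / 2\<rceil>\<rceil>"
  have M: "M > 0" using m_ge_1 by auto
  \<comment> \<open>The defining inequalities of the ceiling, which become the integer hypotheses on
    \<open>q\<close> after multiplication by \<open>M\<close>.\<close>
  have "q - 1 < real n / M" "real n / M \<le> q"
    unfolding q_def half by linarith+
  then have "real_of_int ((q - 1) * M) < real_of_int (int n)" "real_of_int (int n) \<le> real_of_int (q * M)"
    using M by (simp_all add: field_simps)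
  then have "(q - 1) * M < int n" "int n \<le> q * M" by (simp_all only: of_int_less_iff of_int_le_iff)
  then show ?thesis
    using beta_gamma_field_eq unfolding q_def S_chars_def by blast
qed

end
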